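(* As $\mathcal{L}_{\mathrm{B}}$-structures, for every $n\ge2$: (a) the open orthant $O=\{x\in\mathbb{R}^n:x_1>0,\dots,x_n>0\}$ is isomorphic to an open simplex; (b) the open slab $\Sigma_n=\{x\in\mathbb{R}^n:0<x_n<1\}$ is isomorphic to an open half-space; (c) the open paraboloid region $\Pi=\{x\in\mathbb{R}^n:x_n>x_1^2+\dots+x_{n-1}^2\}$ is isomorphic to the open unit ball of $\mathbb{R}^n$; (d) the closed paraboloid region $\overline\Pi=\{x\in\mathbb{R}^n:x_n\ge x_1^2+\dots+x_{n-1}^2\}$ is isomorphic to the closed unit ball of $\mathbb{R}^n$ minus a single boundary point; (e) the open solid cone $C=\{x\in\mathbb{R}^n:x_n>0,\ x_1^2+\dots+x_{n-1}^2<x_n^2\}$ is isomorphic to the open half-cylinder $B^{n-1}\times(0,\infty)$, where $B^{n-1}$ is the open unit ball of $\mathbb{R}^{n-1}$.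
   Context: $\mathcal{L}_{\mathrm{B}}$ is the first-order language with a single ternary relation symbol $B$. A convex set $K\subseteq\mathbb{R}^n$ is an $\mathcal{L}_{\mathrm{B}}$-structure with universe $K$, where $B(a,x,b)$ holds iff $x\in[a,b]$ (the closed segment). Thus an isomorphism is a bijection preserving betweenness in both directions. An open simplex, open half-space etc. is a full-dimensional one in $\mathbb{R}^n$. *)

theory Defs
  imports "HOL-Analysis.Analysis"
begin

definition betw :: "'a::real_vector \<Rightarrow> 'a \<Rightarrow> 'a \<Rightarrow> bool" where
  "betw a x b \<longleftrightarrow> x \<in> closed_segment a b"

definition betw_iso :: "('a::real_vector \<Rightarrow> 'b::real_vector) \<Rightarrow> 'a set \<Rightarrow> 'b set \<Rightarrow> bool" where
  "betw_iso f K L \<longleftrightarrow> bij_betw f K L \<and>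
     (\<forall>a\<in>K. \<forall>x\<in>K. \<forall>b\<in>K. betw a x b \<longleftrightarrow> betw (f a) (f x) (f b))"

definition betw_isomorphic :: "'a::real_vector set \<Rightarrow> 'b::real_vector set \<Rightarrow> bool" where
  "betw_isomorphic K L \<longleftrightarrow> (\<exists>f. betw_iso f K L)"

definition open_simplex :: "'a::euclidean_space set \<Rightarrow> bool" where
  "open_simplex S \<longleftrightarrow> (\<exists>T. int DIM('a) simplex T \<and> S = interior T)"

definition open_halfspace :: "'a::euclidean_space set \<Rightarrow> bool" where
  "open_halfspace H \<longleftrightarrow> (\<exists>a b. a \<noteq> 0 \<and> H = {x. a \<bullet> x < b})"

definition open_orthant :: "(real ^ 'n) set" where
  "open_orthant = {x. \<forall>i. x $ i > 0}"

text \<open>In the definitions below the coordinate \<open>l\<close> plays the role of the last coordinate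
  \<open>x\<^sub>n\<close>; the other coordinates are those indexed by \<open>UNIV - {l}\<close>.\<close>

definition open_slab :: "'n \<Rightarrow> (real ^ 'n) set" where
  "open_slab l = {x. 0 < x $ l \<and> x $ l < 1}"

definition open_paraboloid :: "'n::finite \<Rightarrow> (real ^ 'n) set" where
  "open_paraboloid l = {x. x $ l > (\<Sum>i\<in>UNIV - {l}. (x $ i)\<^sup>2)}"

definition closed_paraboloid :: "'n::finite \<Rightarrow> (real ^ 'n) set" where
  "closed_paraboloid l = {x. x $ l \<ge> (\<Sum>i\<in>UNIV - {l}. (x $ i)\<^sup>2)}"

definition open_cone :: "'n::finite \<Rightarrow> (real ^ 'n) set" where
  "open_cone l = {x. x $ l > 0 \<and> (\<Sum>i\<in>UNIV - {l}. (x $ i)\<^sup>2) < (x $ l)\<^sup>2}"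

text \<open>The product of the open unit ball in the coordinates other than \<open>l\<close> with the open
  half-line of positive reals in the coordinate \<open>l\<close>.\<close>

definition open_half_cylinder :: "'n::finite \<Rightarrow> (real ^ 'n) set" where
  "open_half_cylinder l = {x. (\<Sum>i\<in>UNIV - {l}. (x $ i)\<^sup>2) < 1 \<and> x $ l > 0}"

end

theory Submission
  imports Defs
begin

text \<open>All five isomorphisms are projective maps \<open>x \<mapsto> A x / \<phi> x\<close> with \<open>A\<close> and \<open>\<phi>\<close> affine. Such a map
  carries segments to segments wherever \<open>\<phi>\<close> is positive, and in each case its inverse has the same
  shape. The hyperplane \<open>\<phi> = 0\<close>, which is sent to infinity, misses the region: it is
  \<open>\<Sum>x\<^sub>i = -1\<close> for the orthant, \<open>x\<^sub>n = 1\<close> for the slab, \<open>x\<^sub>n = -1\<close> for the paraboloid and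
  \<open>x\<^sub>n = 0\<close> for the cone.\<close>

section \<open>Projective maps preserve betweenness\<close>

definition affine_map :: "('a::real_vector \<Rightarrow> 'b::real_vector) \<Rightarrow> bool" where
  "affine_map h \<longleftrightarrow>
     (\<forall>a b u. h ((1 - u) *\<^sub>R a + u *\<^sub>R b) = (1 - u) *\<^sub>R h a + u *\<^sub>R h b)"

text \<open>Dividing by a positive affine function only reweights a convex combination: the weights
  \<open>1 - u\<close> and \<open>u\<close> become \<open>(1 - u) * \<phi> a / \<phi> x\<close> and
  \<open>u * \<phi> b / \<phi> x\<close>, which are nonnegative and add up to 1 because
  \<open>\<phi>\<close> is affine.\<close>

lemma projective_betw:
  assumes A: "affine_map A" and \<phi>: "affine_map \<phi>"
    and pos: "\<phi> a > 0" "\<phi> b > (0::real)" and x: "betw a x b"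
  shows "betw (A a /\<^sub>R \<phi> a) (A x /\<^sub>R \<phi> x) (A b /\<^sub>R \<phi> b)"
proof -
  obtain u where u: "0 \<le> u" "u \<le> 1" and xu: "x = (1 - u) *\<^sub>R a + u *\<^sub>R b"
    using x by (auto simp: betw_def in_segment)
  have \<phi>x: "\<phi> x = (1 - u) * \<phi> a + u * \<phi> b" and Ax: "A x = (1 - u) *\<^sub>R A a + u *\<^sub>R A b"
    using A \<phi> by (simp_all add: affine_map_def xu)
  have px: "\<phi> x > 0"
  proof (cases "u = 0")
    case False
    then show ?thesis
      unfolding \<phi>x using u pos by (intro add_nonneg_pos mult_nonneg_nonneg mult_pos_pos) auto
  qed (use pos \<phi>x in simp)
  define v where "v = u * \<phi> b / \<phi> x"
  have v1: "1 - v = (1 - u) * \<phi> a / \<phi> x"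
    using px by (simp add: v_def field_simps \<phi>x)
  have "0 \<le> v" "0 \<le> 1 - v"
    using u pos px unfolding v1 by (simp_all add: v_def)
  moreover have "A x /\<^sub>R \<phi> x = (1 - v) *\<^sub>R (A a /\<^sub>R \<phi> a) + v *\<^sub>R (A b /\<^sub>R \<phi> b)"
  proof -
    have "(1 - v) * inverse (\<phi> a) = (1 - u) * inverse (\<phi> x)" "v * inverse (\<phi> b) = u * inverse (\<phi> x)"
      unfolding v1 using pos by (simp_all add: v_def divide_inverse)
    then show ?thesis
      by (simp add: Ax scaleR_add_right mult.commute)
  qed
  ultimately show ?thesis
    by (auto simp: betw_def in_segment)
qed

text \<open>Betweenness is reflected by \<open>f\<close> because the inverse \<open>g\<close> is
  projective too: apply \<open>projective_betw\<close> to \<open>g\<close> and cancel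
  \<open>g (f x) = x\<close>.\<close>

lemma projective_betw_iso:
  fixes A :: "'a::real_vector \<Rightarrow> 'b::real_vector"
  assumes "affine_map A" "affine_map \<phi>" "affine_map A'" "affine_map \<phi>'"
    and "\<And>x. x \<in> K \<Longrightarrow> \<phi> x > (0::real)" "\<And>y. y \<in> L \<Longrightarrow> \<phi>' y > (0::real)"
    and fL: "\<And>x. x \<in> K \<Longrightarrow> A x /\<^sub>R \<phi> x \<in> L" and gK: "\<And>y. y \<in> L \<Longrightarrow> A' y /\<^sub>R \<phi>' y \<in> K"
    and gf: "\<And>x. x \<in> K \<Longrightarrow> A' (A x /\<^sub>R \<phi> x) /\<^sub>R \<phi>' (A x /\<^sub>R \<phi> x) = x"
    and fg: "\<And>y. y \<in> L \<Longrightarrow> A (A' y /\<^sub>R \<phi>' y) /\<^sub>R \<phi> (A' y /\<^sub>R \<phi>' y) = y"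
  shows "betw_isomorphic K L"
proof -
  define f where "f = (\<lambda>x. A x /\<^sub>R \<phi> x)"
  define g where "g = (\<lambda>y. A' y /\<^sub>R \<phi>' y)"
  have "bij_betw f K L"
    by (rule bij_betw_byWitness[where f' = g]) (use fL gK gf fg in \<open>auto simp: f_def g_def\<close>)
  moreover have "betw (f a) (f x) (f b)" if "a \<in> K" "b \<in> K" "betw a x b" for a x b
    using that assms unfolding f_def by (intro projective_betw) auto
  moreover have "betw (g a) (g x) (g b)" if "a \<in> L" "b \<in> L" "betw a x b" for a x b
    using that assms unfolding g_def by (intro projective_betw) auto
  moreover have "g (f x) = x" "f x \<in> L" if "x \<in> K" for x
    using that gf fL by (auto simp: f_def g_def)
  ultimately have "betw_iso f K L"
    unfolding betw_iso_def by metis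
  then show ?thesis
    by (auto simp: betw_isomorphic_def)
qed

section \<open>Orthant and simplex\<close>

text \<open>The map rescales each ray from the origin. It turns the coordinate sum \<open>s\<close>
  into \<open>s / (1 + s)\<close>, which ranges over (0,1), and \<open>s / (1 - s)\<close> undoes
  this.\<close>

lemma orthant_betw_isomorphic_simplex:
  "betw_isomorphic (open_orthant :: (real ^ 'n) set)
     {x :: real ^ 'n. (\<forall>i. 0 < x $ i) \<and> (\<Sum>i\<in>UNIV. x $ i) < 1}"
proof (rule projective_betw_iso[where A = "\<lambda>x. x" and \<phi> = "\<lambda>x. 1 + (\<Sum>i\<in>UNIV. x $ i)"
      and A' = "\<lambda>x. x" and \<phi>' = "\<lambda>x. 1 - (\<Sum>i\<in>UNIV. x $ i)"])
  show "affine_map (\<lambda>x::real^'n. 1 + (\<Sum>i\<in>UNIV. x $ i))"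
    "affine_map (\<lambda>x::real^'n. 1 - (\<Sum>i\<in>UNIV. x $ i))"
    by (simp_all add: affine_map_def sum.distrib flip: sum_distrib_left) (simp_all add: algebra_simps)
next
  fix x :: "real ^ 'n"
  assume x: "x \<in> open_orthant"
  define s where "s = (\<Sum>i\<in>UNIV. x $ i)"
  have s: "s > 0"
    using x by (auto simp: open_orthant_def s_def intro!: sum_pos)
  have S: "(\<Sum>i\<in>UNIV. (x /\<^sub>R (1 + s)) $ i) = s / (1 + s)"
    by (simp add: s_def divide_inverse mult.commute flip: sum_distrib_right)
  show "1 + (\<Sum>i\<in>UNIV. x $ i) > 0"
    using s by (simp add: s_def)
  show "x /\<^sub>R (1 + (\<Sum>i\<in>UNIV. x $ i)) \<in> {x. (\<forall>i. 0 < x $ i) \<and> (\<Sum>i\<in>UNIV. x $ i) < 1}"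
    unfolding s_def[symmetric] using s x S by (simp add: open_orthant_def)
  have "1 - s / (1 + s) = inverse (1 + s)"
    using s by (simp add: field_simps)
  then show "x /\<^sub>R (1 + (\<Sum>i\<in>UNIV. x $ i)) /\<^sub>R (1 - (\<Sum>i\<in>UNIV. (x /\<^sub>R (1 + (\<Sum>i\<in>UNIV. x $ i))) $ i)) = x"
    unfolding s_def[symmetric] S using s by simp
next
  fix x :: "real ^ 'n"
  assume x: "x \<in> {x. (\<forall>i. 0 < x $ i) \<and> (\<Sum>i\<in>UNIV. x $ i) < 1}"
  define s where "s = (\<Sum>i\<in>UNIV. x $ i)"
  have s: "s < 1"
    using x by (auto simp: s_def)
  have S: "(\<Sum>i\<in>UNIV. (x /\<^sub>R (1 - s)) $ i) = s / (1 - s)"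
    by (simp add: s_def divide_inverse mult.commute flip: sum_distrib_right)
  show "1 - (\<Sum>i\<in>UNIV. x $ i) > 0"
    using s by (simp add: s_def)
  show "x /\<^sub>R (1 - (\<Sum>i\<in>UNIV. x $ i)) \<in> open_orthant"
    unfolding s_def[symmetric] using s x by (simp add: open_orthant_def)
  have "1 + s / (1 - s) = inverse (1 - s)"
    using s by (simp add: field_simps)
  then show "x /\<^sub>R (1 - (\<Sum>i\<in>UNIV. x $ i)) /\<^sub>R (1 + (\<Sum>i\<in>UNIV. (x /\<^sub>R (1 - (\<Sum>i\<in>UNIV. x $ i))) $ i)) = x"
    unfolding s_def[symmetric] S using s by simp
qed (simp add: affine_map_def)+

lemma open_simplex_standard:
  "open_simplex {x :: real ^ 'n. (\<forall>i. 0 < x $ i) \<and> (\<Sum>i\<in>UNIV. x $ i) < 1}"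
proof -
  let ?C = "insert 0 (Basis :: (real ^ 'n) set)"
  \<comment> \<open>This settles the vertex count: a simplex of dimension n has n + 1
    vertices.\<close>
  have "0 \<notin> (Basis :: (real ^ 'n) set)"
    by auto
  moreover have "\<not> affine_dependent ?C"
    using independent_Basis by (simp add: affine_dependent_iff_dependent2 affine_dependent_iff_dependent)
  ultimately have "int DIM(real ^ 'n) simplex convex hull ?C"
    unfolding simplex_def by (intro exI[of _ ?C]) simp
  moreover have "interior (convex hull ?C) = {x. (\<forall>i. 0 < x $ i) \<and> (\<Sum>i\<in>UNIV. x $ i) < 1}"
  proof -
    \<comment> \<open>\<open>interior_std_simplex\<close> speaks of inner products with
      \<open>Basis\<close>; indexing the basis by \<open>axis i 1\<close> turns them into
      coordinates.\<close>
    have Basis: "Basis = range (\<lambda>i. axis i 1 :: real ^ 'n)"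
      by (auto simp: Basis_vec_def)
    have "sum ((\<bullet>) x) Basis = (\<Sum>i\<in>UNIV. x $ i)" for x :: "real ^ 'n"
      unfolding Basis by (subst sum.reindex) (auto simp: inj_on_def axis_eq_axis inner_axis)
    moreover have "(\<forall>b\<in>Basis. 0 < x \<bullet> b) \<longleftrightarrow> (\<forall>i. 0 < x $ i)" for x :: "real ^ 'n"
      by (auto simp: Basis_vec_def inner_axis)
    ultimately show ?thesis
      unfolding interior_std_simplex by simp
  qed
  ultimately show ?thesis
    unfolding open_simplex_def by metis
qed

section \<open>Slab and half-space\<close>

text \<open>The height t in (0,1) becomes t/(1 - t) in (0,\<infinity>), with inverse t/(1 + t); the
  bounding hyperplane at height 1 goes to infinity.\<close>

lemma slab_betw_isomorphic_halfspace:
  "betw_isomorphic (open_slab l) {x :: real ^ 'n. 0 < x $ l}"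
proof (rule projective_betw_iso[where A = "\<lambda>x. x" and \<phi> = "\<lambda>x. 1 - x $ l"
      and A' = "\<lambda>x. x" and \<phi>' = "\<lambda>x. 1 + x $ l"])
  show "x /\<^sub>R (1 - x $ l) /\<^sub>R (1 + (x /\<^sub>R (1 - x $ l)) $ l) = x" if "x \<in> open_slab l" for x
    using that by (simp add: open_slab_def vec_eq_iff field_simps)
  show "x /\<^sub>R (1 + x $ l) /\<^sub>R (1 - (x /\<^sub>R (1 + x $ l)) $ l) = x" if "x \<in> {x. 0 < x $ l}" for x
    using that by (simp add: vec_eq_iff field_simps)
qed (auto simp: affine_map_def open_slab_def field_simps)

lemma open_halfspace_coordinate_pos: "open_halfspace {x :: real ^ 'n. 0 < x $ l}"
  unfolding open_halfspace_def
  by (intro exI[of _ "- axis l 1"] exI[of _ 0]) (simp add: inner_axis' axis_eq_0_iff)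

section \<open>Paraboloids and balls\<close>

text \<open>The squared distance from the \<open>l\<close>-axis, in which the paraboloids, the cone
  and the cylinder can all be described.\<close>

definition side_norm2 :: "'n::finite \<Rightarrow> real ^ 'n \<Rightarrow> real" where
  "side_norm2 l x = (\<Sum>i\<in>UNIV - {l}. (x $ i)\<^sup>2)"

lemma side_norm2_nonneg: "side_norm2 l x \<ge> 0"
  by (simp add: side_norm2_def sum_nonneg)

lemma side_norm2_scale:
  assumes "\<And>i. i \<noteq> l \<Longrightarrow> y $ i = c * x $ i"
  shows "side_norm2 l y = c\<^sup>2 * side_norm2 l x"
  using assms by (simp add: side_norm2_def sum_distrib_left power_mult_distrib)

lemma norm_power2_split: "(norm x)\<^sup>2 = (x $ l)\<^sup>2 + side_norm2 l x"
proof -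
  have "(norm x)\<^sup>2 = (\<Sum>i\<in>UNIV. (x $ i)\<^sup>2)"
    by (simp add: norm_vec_def L2_set_def sum_nonneg)
  then show ?thesis
    by (simp add: side_norm2_def sum.remove[of _ l])
qed

text \<open>With h = \<open>x $ l\<close>, the height becomes (h - 1)/(h + 1) and every other
  coordinate is multiplied by 2/(h + 1). The origin goes to \<open>- axis l 1\<close>, and the
  heights tend to 1 as h grows.\<close>

definition paraboloid_to_ball :: "'n::finite \<Rightarrow> real ^ 'n \<Rightarrow> real ^ 'n" where
  "paraboloid_to_ball l x = (2 *\<^sub>R x - (x $ l + 1) *\<^sub>R axis l 1) /\<^sub>R (x $ l + 1)"

text \<open>With h the height and s the \<open>side_norm2\<close> of \<open>x\<close>, this is (h -
  1)^2 + 4s = (h + 1)^2 - 4(h - s) divided by (h + 1)^2. The sign of h - s thus decides on which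
  side of the unit sphere the image lies.\<close>

lemma paraboloid_to_ball_norm:
  assumes "x $ l \<ge> 0"
  shows "(norm (paraboloid_to_ball l x))\<^sup>2 = 1 - 4 * (x $ l - side_norm2 l x) / (x $ l + 1)\<^sup>2"
proof -
  have "side_norm2 l (paraboloid_to_ball l x) = (2 / (x $ l + 1))\<^sup>2 * side_norm2 l x"
    by (rule side_norm2_scale) (simp add: paraboloid_to_ball_def axis_def field_simps)
  moreover have "paraboloid_to_ball l x $ l = (x $ l - 1) / (x $ l + 1)"
    by (simp add: paraboloid_to_ball_def divide_inverse mult.commute)
  ultimately have "(norm (paraboloid_to_ball l x))\<^sup>2 =
      ((x $ l - 1) / (x $ l + 1))\<^sup>2 + (2 / (x $ l + 1))\<^sup>2 * side_norm2 l x"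
    by (simp add: norm_power2_split[of _ l])
  also have "\<dots> = 1 - 4 * (x $ l - side_norm2 l x) / (x $ l + 1)\<^sup>2"
  proof -
    define d where "d = x $ l + 1"
    have d: "x $ l = d - 1" "d \<noteq> 0"
      using assms by (simp_all add: d_def)
    show ?thesis
      unfolding d(1) using d(2) by (simp add: field_simps power2_eq_square)
  qed
  finally show ?thesis .
qed

text \<open>Solving (h - 1)/(h + 1) = \<open>y $ l\<close> gives h + 1 = 2/(1 -
  \<open>y $ l\<close>), whence this inverse of \<open>paraboloid_to_ball\<close>.\<close>

definition ball_to_paraboloid :: "'n::finite \<Rightarrow> real ^ 'n \<Rightarrow> real ^ 'n" where
  "ball_to_paraboloid l y = (y + axis l 1) /\<^sub>R (1 - y $ l)"

text \<open>Over the common denominator the numerator is (1 + t)(1 - t) - s, where t is the height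
  and s the \<open>side_norm2\<close> of \<open>y\<close>; by \<open>norm_power2_split\<close> this
  is 1 minus the squared norm.\<close>

lemma ball_to_paraboloid_height:
  assumes "y $ l < 1"
  shows "ball_to_paraboloid l y $ l - side_norm2 l (ball_to_paraboloid l y) =
           (1 - (norm y)\<^sup>2) / (1 - y $ l)\<^sup>2"
proof -
  have "side_norm2 l (ball_to_paraboloid l y) = (1 / (1 - y $ l))\<^sup>2 * side_norm2 l y"
    by (rule side_norm2_scale) (simp add: ball_to_paraboloid_def axis_def field_simps)
  moreover have "ball_to_paraboloid l y $ l = (1 + y $ l) / (1 - y $ l)"
    by (simp add: ball_to_paraboloid_def divide_inverse mult.commute add.commute)
  ultimately have "ball_to_paraboloid l y $ l - side_norm2 l (ball_to_paraboloid l y) =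
      (1 + y $ l) / (1 - y $ l) - (1 / (1 - y $ l))\<^sup>2 * side_norm2 l y"
    by simp
  also have "\<dots> = (1 - ((y $ l)\<^sup>2 + side_norm2 l y)) / (1 - y $ l)\<^sup>2"
  proof -
    define d where "d = 1 - y $ l"
    have d: "y $ l = 1 - d" "d \<noteq> 0"
      using assms by (simp_all add: d_def)
    show ?thesis
      unfolding d(1) using d(2) by (simp add: field_simps power2_eq_square)
  qed
  finally show ?thesis
    by (simp add: norm_power2_split[of _ l])
qed

text \<open>Serves the open and the closed case alike. The height bounds keep both denominators
  positive, so only membership of the images remains to be checked in each case.\<close>

lemma paraboloid_betw_isomorphicI:
  assumes K: "\<And>x. x \<in> K \<Longrightarrow> x $ l \<ge> 0" and L: "\<And>y. y \<in> L \<Longrightarrow> y $ l < 1"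
    and "\<And>x. x \<in> K \<Longrightarrow> paraboloid_to_ball l x \<in> L"
    and "\<And>y. y \<in> L \<Longrightarrow> ball_to_paraboloid l y \<in> K"
  shows "betw_isomorphic K L"
proof (rule projective_betw_iso[where A = "\<lambda>x. 2 *\<^sub>R x - (x $ l + 1) *\<^sub>R axis l 1"
      and \<phi> = "\<lambda>x. x $ l + 1" and A' = "\<lambda>y. y + axis l 1" and \<phi>' = "\<lambda>y. 1 - y $ l"],
    unfold paraboloid_to_ball_def[symmetric] ball_to_paraboloid_def[symmetric])
  show "ball_to_paraboloid l (paraboloid_to_ball l x) = x" if "x \<in> K" for x
    using K[OF that] by (simp add: ball_to_paraboloid_def paraboloid_to_ball_def vec_eq_iff field_simps)
  show "paraboloid_to_ball l (ball_to_paraboloid l y) = y" if "y \<in> L" for y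
    using L[OF that] by (simp add: ball_to_paraboloid_def paraboloid_to_ball_def vec_eq_iff field_simps)
  show "x $ l + 1 > 0" if "x \<in> K" for x
    using K[OF that] by simp
qed (use assms in \<open>auto simp: affine_map_def vec_eq_iff algebra_simps\<close>)

lemma open_paraboloid_betw_isomorphic_ball:
  "betw_isomorphic (open_paraboloid (l :: 'n :: finite)) (ball (0 :: real ^ 'n) 1)"
proof (rule paraboloid_betw_isomorphicI[where l = l])
  fix x :: "real ^ 'n"
  assume "x \<in> open_paraboloid l"
  then have x: "side_norm2 l x < x $ l"
    by (simp add: open_paraboloid_def side_norm2_def)
  show pos: "x $ l \<ge> 0"
    using x side_norm2_nonneg[of l x] by simp
  have "(norm (paraboloid_to_ball l x))\<^sup>2 < 1"
    using x pos by (simp add: paraboloid_to_ball_norm)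
  then show "paraboloid_to_ball l x \<in> ball 0 1"
    by (simp add: abs_square_less_1)
next
  fix y :: "real ^ 'n"
  assume y: "y \<in> ball 0 1"
  show less: "y $ l < 1"
    using y component_le_norm_cart[of y l] by simp
  have "(norm y)\<^sup>2 < 1"
    using y by (simp add: abs_square_less_1)
  then have "ball_to_paraboloid l y $ l - side_norm2 l (ball_to_paraboloid l y) > 0"
    using less by (simp add: ball_to_paraboloid_height)
  then show "ball_to_paraboloid l y \<in> open_paraboloid l"
    by (simp add: open_paraboloid_def side_norm2_def)
qed

text \<open>The point \<open>axis l 1\<close> is the only one of the closed ball at which the
  denominator \<open>1 - y $ l\<close> vanishes.\<close>

lemma closed_paraboloid_betw_isomorphic_cball:
  "betw_isomorphic (closed_paraboloid (l :: 'n :: finite)) (cball (0 :: real ^ 'n) 1 - {axis l 1})"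
proof (rule paraboloid_betw_isomorphicI[where l = l])
  fix x :: "real ^ 'n"
  assume "x \<in> closed_paraboloid l"
  then have x: "side_norm2 l x \<le> x $ l"
    by (simp add: closed_paraboloid_def side_norm2_def)
  show pos: "x $ l \<ge> 0"
    using x side_norm2_nonneg[of l x] by simp
  \<comment> \<open>The height (h - 1)/(h + 1) never reaches 1, so the pole is missed.\<close>
  have "paraboloid_to_ball l x $ l \<noteq> 1"
    using pos by (simp add: paraboloid_to_ball_def field_simps)
  then have "paraboloid_to_ball l x \<noteq> axis l 1"
    by auto
  moreover have "(norm (paraboloid_to_ball l x))\<^sup>2 \<le> 1"
    using x pos by (simp add: paraboloid_to_ball_norm)
  ultimately show "paraboloid_to_ball l x \<in> cball 0 1 - {axis l 1}"
    by (simp add: abs_square_le_1)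
next
  fix y :: "real ^ 'n"
  assume y: "y \<in> cball 0 1 - {axis l 1}"
  have n: "(norm y)\<^sup>2 \<le> 1"
    using y by (simp add: abs_square_le_1)
  \<comment> \<open>In the closed ball, height 1 already uses up the whole norm, so the other
    coordinates vanish and \<open>y\<close> is the removed pole.\<close>
  have "y $ l \<noteq> 1"
  proof
    assume 1: "y $ l = 1"
    then have "side_norm2 l y = 0"
      using n side_norm2_nonneg[of l y] by (simp add: norm_power2_split[of _ l])
    then have "y = axis l 1"
      using 1 by (auto simp: side_norm2_def sum_nonneg_eq_0_iff vec_eq_iff axis_def)
    then show False
      using y by simp
  qed
  moreover have "y $ l \<le> 1"
    using y component_le_norm_cart[of y l] by auto
  ultimately show less: "y $ l < 1"
    by simp
  have "ball_to_paraboloid l y $ l - side_norm2 l (ball_to_paraboloid l y) \<ge> 0"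
    using less n by (simp add: ball_to_paraboloid_height)
  then show "ball_to_paraboloid l y \<in> closed_paraboloid l"
    by (simp add: closed_paraboloid_def side_norm2_def)
qed

section \<open>Cone and half-cylinder\<close>

text \<open>Replacing the height by 1 and dividing by the old height h sends (z,h) to (z/h, 1/h).
  This is an involution on h > 0, so one map serves in both directions; it turns |z|^2 < h^2 into
  |z/h|^2 < 1.\<close>

lemma open_cone_betw_isomorphic_half_cylinder:
  "betw_isomorphic (open_cone l :: (real ^ 'n) set) (open_half_cylinder l)"
proof -
  let ?A = "\<lambda>x :: real ^ 'n. x + (1 - x $ l) *\<^sub>R axis l 1"
  let ?\<phi> = "\<lambda>x :: real ^ 'n. x $ l"
  \<comment> \<open>This and \<open>comp\<close> hold even for \<open>x $ l = 0\<close>, where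
    division by 0 makes both sides 0.\<close>
  have side: "side_norm2 l (?A x /\<^sub>R ?\<phi> x) = side_norm2 l x / (x $ l)\<^sup>2" for x
    using side_norm2_scale[of l "?A x /\<^sub>R ?\<phi> x" "1 / x $ l" x]
    by (simp add: axis_def field_simps)
  have cone: "open_cone l = {x. x $ l > 0 \<and> side_norm2 l x < (x $ l)\<^sup>2}"
    and cyl: "open_half_cylinder l = {x. side_norm2 l x < 1 \<and> x $ l > 0}"
    by (simp_all add: open_cone_def open_half_cylinder_def side_norm2_def)
  have comp: "(?A x /\<^sub>R ?\<phi> x) $ l = 1 / x $ l" for x
    by (simp add: field_simps)
  have inv: "?A (?A x /\<^sub>R ?\<phi> x) /\<^sub>R ?\<phi> (?A x /\<^sub>R ?\<phi> x) = x" if "x $ l > 0" for x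
    unfolding comp using that by (simp add: vec_eq_iff axis_def field_simps)
  have affine: "affine_map ?A" "affine_map ?\<phi>"
    by (auto simp: affine_map_def vec_eq_iff algebra_simps)
  show ?thesis
  proof (rule projective_betw_iso[where A = ?A and \<phi> = ?\<phi> and A' = ?A and \<phi>' = ?\<phi>, OF affine affine])
    show "?A x /\<^sub>R ?\<phi> x \<in> open_half_cylinder l" if "x \<in> open_cone l" for x
      using that unfolding cone cyl mem_Collect_eq side comp by simp
    \<comment> \<open>With s the \<open>side_norm2\<close> and h the height of \<open>x\<close>, the
      cone condition on the image is s/h^2 < (1/h)^2, which is s < 1 divided by h^2.\<close>
    show "?A x /\<^sub>R ?\<phi> x \<in> open_cone l" if "x \<in> open_half_cylinder l" for x
      using that unfolding cone cyl mem_Collect_eq side comp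
      by (simp add: power_divide divide_strict_right_mono)
  qed (use inv in \<open>auto simp: cone cyl\<close>)
qed

theorem proposition10p2:
  fixes l :: "'n::finite"
  assumes "CARD('n) \<ge> 2"
  shows "(\<exists>S :: (real ^ 'n) set. open_simplex S \<and> betw_isomorphic (open_orthant :: (real ^ 'n) set) S) \<and>
    (\<exists>H :: (real ^ 'n) set. open_halfspace H \<and> betw_isomorphic (open_slab l) H) \<and>
    betw_isomorphic (open_paraboloid l) (ball (0 :: real ^ 'n) 1) \<and>
    (\<exists>p \<in> sphere (0 :: real ^ 'n) 1. betw_isomorphic (closed_paraboloid l) (cball (0 :: real ^ 'n) 1 - {p})) \<and>
    betw_isomorphic (open_cone l) (open_half_cylinder l)"
proof (intro conjI)
  show "\<exists>S :: (real ^ 'n) set. open_simplex S \<and> betw_isomorphic (open_orthant :: (real ^ 'n) set) S"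
    using open_simplex_standard orthant_betw_isomorphic_simplex by blast
  show "\<exists>H :: (real ^ 'n) set. open_halfspace H \<and> betw_isomorphic (open_slab l) H"
    using open_halfspace_coordinate_pos slab_betw_isomorphic_halfspace by blast
  show "\<exists>p \<in> sphere (0 :: real ^ 'n) 1. betw_isomorphic (closed_paraboloid l) (cball 0 1 - {p})"
    using closed_paraboloid_betw_isomorphic_cball by (intro bexI[of _ "axis l 1"]) auto
qed (fact open_paraboloid_betw_isomorphic_ball open_cone_betw_isomorphic_half_cylinder)+

end
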